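(* Let $\mathcal{S} \subseteq M_n$ be a quantum graph. Then $\mathcal{S}$ is disconnected if and only if there exists a projection $P \in M_n$ with $P \neq 0$ and $P \neq I_n$ such that $P \mathcal{S} (I_n-P) = \{0\}$.
   Context: $M_n$ denotes the $n\times n$ complex matrices, $I_n$ the identity matrix. A projection is $P\in M_n$ with $P=P^2=P^\dagger$. A quantum graph on $M_n$ is an operator system: a linear subspace $\mathcal{S}\subseteq M_n$ closed under taking adjoints and containing $I_n$. For subspaces $\mathcal{U},\mathcal{V}\subseteq M_n$, $\mathcal{U}\mathcal{V}=\operatorname{span}\{UV : U\in\mathcal{U}, V\in\mathcal{V}\}$, $\mathcal{U}^0=\mathbb{C}I_n$ and $\mathcal{U}^{k+1}=\mathcal{U}^k\mathcal{U}$. For subsets, $P\mathcal{S}Q=\{PAQ : A\in\mathcal{S}\}$. A quantum graph $\mathcal{S}\subseteq M_n$ is connected if there exists $m\in\mathbb{N}$ with $\mathcal{S}^m=M_n$, and disconnected otherwise. *)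

theory Defs
  imports "HOL-Analysis.Analysis"
begin

text \<open>M_n is modelled as complex^'n^'n for a finite index type 'n (n = CARD('n)).
  Linear structure is COMPLEX-linear: scalar multiplication entrywise by complex numbers.\<close>

definition cscale :: "complex \<Rightarrow> complex^'n^'n \<Rightarrow> complex^'n^'n" where
  "cscale c A = (\<chi> i j. c * A$i$j)"

definition csubspace :: "(complex^'n^'n) set \<Rightarrow> bool" where
  "csubspace S = module.subspace cscale S"

definition cspan :: "(complex^'n^'n) set \<Rightarrow> (complex^'n^'n) set" where
  "cspan S = module.span cscale S"

definition adj :: "complex^'n^'n \<Rightarrow> complex^'n^'n" where
  "adj A = (\<chi> i j. cnj (A$j$i))"

definition operator_system :: "(complex^'n^'n) set \<Rightarrow> bool" where
  "operator_system S \<longleftrightarrow> csubspace S \<and> mat 1 \<in> S \<and> (\<forall>A\<in>S. adj A \<in> S)"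

definition subspace_prod :: "(complex^'n^'n) set \<Rightarrow> (complex^'n^'n) set \<Rightarrow> (complex^'n^'n) set" where
  "subspace_prod U V = cspan {A ** B | A B. A \<in> U \<and> B \<in> V}"

fun subspace_pow :: "(complex^'n^'n) set \<Rightarrow> nat \<Rightarrow> (complex^'n^'n) set" where
  "subspace_pow S 0 = cspan {mat 1}"
| "subspace_pow S (Suc k) = subspace_prod (subspace_pow S k) S"

definition qgraph_connected :: "(complex^'n^'n) set \<Rightarrow> bool" where
  "qgraph_connected S \<longleftrightarrow> (\<exists>m. subspace_pow S m = UNIV)"

definition projection :: "complex^'n^'n \<Rightarrow> bool" where
  "projection P \<longleftrightarrow> P ** P = P \<and> adj P = P"

end

(* If P S (I - P) = 0 for a projection P other than 0 and I, then also (I - P) S P = 0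
   because S is closed under adjoints, so P commutes with S and hence with every power S^m.
   Not every matrix commutes with such a P, so no power S^m is all of M_n.

   Conversely, suppose no such P exists. The union A of the increasing powers S^k is a unital
   *-algebra, and the orthogonal projection onto A x reduces A, so A x is the whole space for
   every x <> 0. Take a nonzero Hermitian T in A of least rank. For Hermitian h in A, let y in the
   range of T maximise the Rayleigh quotient of h there, with maximum l; then T (l - h) T is a
   Hermitian element of A of smaller rank, since T (l - h) annihilates y, so it vanishes. Hence
   T A T lies in the line through T^2, which together with transitivity forces T to have rank one.
   Multiplying T on both sides by elements of A gives every matrix unit, and since the powers
   increase, a single power S^m contains all of them. *)

theory Submission
  imports Defs
begin

section \<open>Matrix algebra\<close>

definition matrix_unit :: "'n \<Rightarrow> 'm \<Rightarrow> 'a::zero_neq_one^'m^'n" where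
  "matrix_unit i j = (\<chi> r s. if r = i \<and> s = j then 1 else 0)"

lemma cscale_nth [simp]: "cscale c A $ i $ j = c * A $ i $ j"
  by (simp add: cscale_def)

lemma adj_nth [simp]: "adj A $ i $ j = cnj (A $ j $ i)"
  by (simp add: adj_def)

interpretation cm: module cscale
  by unfold_locales (simp_all add: vec_eq_iff algebra_simps)

lemma matrix_add_rdistrib: "(B + C) ** A = B ** A + C ** (A::'a::semiring_1^'n^'m)"
  by (vector matrix_matrix_mult_def sum.distrib[symmetric] field_simps)

lemma matrix_diff_ldistrib: "A ** (B - C) = A ** B - A ** (C::'a::ring_1^'n^'m)"
  by (vector matrix_matrix_mult_def sum_subtractf[symmetric] field_simps)

lemma matrix_diff_rdistrib: "(B - C) ** A = B ** A - C ** (A::'a::ring_1^'n^'m)"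
  by (vector matrix_matrix_mult_def sum_subtractf[symmetric] field_simps)

lemma cscale_mult_left: "cscale c A ** B = cscale c (A ** B)"
  by (simp add: vec_eq_iff matrix_matrix_mult_def sum_distrib_left mult.assoc)

lemma cscale_mult_right: "A ** cscale c B = cscale c (A ** B)"
  by (simp add: vec_eq_iff matrix_matrix_mult_def sum_distrib_left mult.left_commute)

lemma mult_mat_eq_cscale: "A ** mat c = cscale c A"
  by (simp add: vec_eq_iff matrix_matrix_mult_def mat_def if_distrib if_distribR sum.delta'
      mult.commute cong: if_cong)

lemma cscale_mv: "cscale c A *v x = c *s (A *v x)"
  by (simp add: vec_eq_iff matrix_vector_mult_def sum_distrib_left mult.assoc)

lemma mat_mult_vector: "mat c *v x = c *s (x::'a::semiring_1^'n)"
  by (simp add: vec_eq_iff matrix_vector_mult_def mat_def if_distrib if_distribR sum.delta'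
      cong: if_cong)

lemma mat_eq_cscale: "mat c = cscale c (mat 1)"
  by (simp add: vec_eq_iff mat_def)

lemma matrix_vector_mult_axis_nth: "((A::'a::semiring_1^'n^'m) *v axis j 1) $ i = A $ i $ j"
  by (simp add: matrix_vector_mult_def axis_def if_distrib if_distribR sum.delta' cong: if_cong)

lemma adj_adj [simp]: "adj (adj A) = A"
  by (simp add: vec_eq_iff)

lemma adj_mult: "adj (A ** B) = adj B ** adj A"
  by (simp add: vec_eq_iff matrix_matrix_mult_def mult.commute)

lemma adj_add: "adj (A + B) = adj A + adj B"
  by (simp add: vec_eq_iff)

lemma adj_diff: "adj (A - B) = adj A - adj B"
  by (simp add: vec_eq_iff)

lemma adj_cscale: "adj (cscale c A) = cscale (cnj c) (adj A)"
  by (simp add: vec_eq_iff)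

lemma adj_mat [simp]: "adj (mat c) = mat (cnj c)"
  by (simp add: vec_eq_iff mat_def)

lemma adj_zero [simp]: "adj 0 = 0"
  by (simp add: vec_eq_iff)

lemma matrix_unit_sandwich_nth:
  fixes A :: "'a::comm_semiring_1^'n^'m" and B :: "'a^'q^'p"
  shows "(A ** matrix_unit j k ** B) $ a $ b = A $ a $ j * B $ k $ b"
proof -
  have row: "(A ** matrix_unit j k) $ a $ l = (if l = k then A $ a $ j else 0)" for l
    by (cases "l = k") (simp_all add: matrix_matrix_mult_def matrix_unit_def if_distrib sum.delta' cong: if_cong)
  show ?thesis
    unfolding matrix_matrix_mult_def[of "A ** matrix_unit j k" B]
    by (simp add: row if_distrib if_distribR sum.delta' cong: if_cong)
qed

lemma sandwiches_eq_0_imp: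
  fixes A B :: "'a::field^'n^'n"
  assumes "\<And>X. A ** X ** B = 0"
  shows "A = 0 \<or> B = 0"
proof (rule ccontr)
  assume "\<not> (A = 0 \<or> B = 0)"
  then obtain a j k b where "A $ a $ j \<noteq> 0" "B $ k $ b \<noteq> 0"
    by (auto simp: vec_eq_iff)
  then have "(A ** matrix_unit j k ** B) $ a $ b \<noteq> 0"
    by (simp add: matrix_unit_sandwich_nth)
  with assms show False by simp
qed

lemma matrix_eq_sum_matrix_units:
  "X = (\<Sum>p\<in>UNIV. cscale (X $ fst p $ snd p) (matrix_unit (fst p) (snd p)))"
proof -
  have "(\<Sum>p\<in>UNIV. cscale (X $ fst p $ snd p) (matrix_unit (fst p) (snd p))) $ i $ j
      = (\<Sum>p\<in>UNIV. if p = (i, j) then X $ i $ j else 0)" for i j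
    unfolding sum_component by (intro sum.cong) (auto simp: matrix_unit_def)
  then show ?thesis by (simp add: vec_eq_iff)
qed

lemma csubspace_eq_UNIV_if_matrix_units:
  assumes "csubspace V" "\<And>r s. matrix_unit r s \<in> V"
  shows "V = UNIV"
proof -
  have "X \<in> V" for X
    using assms matrix_eq_sum_matrix_units[of X]
    by (metis (no_types, lifting) cm.subspace_scale cm.subspace_sum csubspace_def)
  then show ?thesis by blast
qed

lemma commute_if_off_diagonal_blocks_zero:
  fixes P A :: "'a::ring_1^'n^'n"
  assumes "P ** A ** (mat 1 - P) = 0" "(mat 1 - P) ** A ** P = 0"
  shows "P ** A = A ** P"
proof -
  have "P ** A = P ** A ** P"
    using assms(1) by (simp add: matrix_diff_ldistrib)
  also have "\<dots> = A ** P"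
    using assms(2) by (simp add: matrix_diff_rdistrib matrix_mul_assoc)
  finally show ?thesis .
qed

lemma adj_off_diagonal_block:
  assumes "projection P"
  shows "adj (P ** A ** (mat 1 - P)) = (mat 1 - P) ** adj A ** P"
  using assms by (simp add: projection_def adj_mult adj_diff matrix_mul_assoc)

section \<open>Powers of an operator system\<close>

declare subspace_pow.simps(2) [simp del]

lemma subspace_pow_subsetI:
  assumes "\<And>k. csubspace (Q k)" and "mat 1 \<in> Q 0"
    and "\<And>k X A. X \<in> Q k \<Longrightarrow> A \<in> S \<Longrightarrow> X ** A \<in> Q (Suc k)"
  shows "subspace_pow S k \<subseteq> Q k"
proof (induction k)
  case 0
  show ?case
    using assms(1,2) by (simp add: cspan_def csubspace_def cm.span_minimal)
next
  case (Suc k)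
  have "{X ** A |X A. X \<in> subspace_pow S k \<and> A \<in> S} \<subseteq> Q (Suc k)"
    using Suc assms(3) by blast
  then show ?case
    using assms(1) by (simp add: subspace_pow.simps(2) subspace_prod_def cspan_def csubspace_def
        cm.span_minimal)
qed

lemma csubspace_subspace_pow: "csubspace (subspace_pow S k)"
  by (cases k) (simp_all add: subspace_pow.simps(2) subspace_prod_def cspan_def csubspace_def)

lemma mult_mem_subspace_pow_Suc:
  "X \<in> subspace_pow S k \<Longrightarrow> A \<in> S \<Longrightarrow> X ** A \<in> subspace_pow S (Suc k)"
  by (auto simp: subspace_pow.simps(2) subspace_prod_def cspan_def intro: cm.span_base)

lemma mat_1_mem_subspace_pow:
  assumes "operator_system S"
  shows "mat 1 \<in> subspace_pow S k"
proof (induction k)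
  case 0
  show ?case by (simp add: cspan_def cm.span_base)
next
  case (Suc k)
  then have "mat 1 ** mat 1 \<in> subspace_pow S (Suc k)"
    using assms by (intro mult_mem_subspace_pow_Suc) (auto simp: operator_system_def)
  then show ?case by simp
qed

lemma subset_subspace_pow_1:
  assumes "operator_system S"
  shows "S \<subseteq> subspace_pow S (Suc 0)"
  using mult_mem_subspace_pow_Suc[OF mat_1_mem_subspace_pow[OF assms], of _ 0] by fastforce

lemma subspace_pow_mono:
  assumes "operator_system S" and "j \<le> k"
  shows "subspace_pow S j \<subseteq> subspace_pow S k"
proof -
  have "subspace_pow S k \<subseteq> subspace_pow S (Suc k)" for k
  proof (rule subspace_pow_subsetI)
    show "mat 1 \<in> subspace_pow S (Suc 0)"
      by (rule mat_1_mem_subspace_pow[OF assms(1)])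
  qed (simp_all add: csubspace_subspace_pow mult_mem_subspace_pow_Suc)
  then show ?thesis
    using assms(2) by (rule lift_Suc_mono_le)
qed

lemma subspace_pow_mult:
  assumes "X \<in> subspace_pow S j" and "Y \<in> subspace_pow S k"
  shows "X ** Y \<in> subspace_pow S (j + k)"
proof -
  have "subspace_pow S k \<subseteq> {Y. X ** Y \<in> subspace_pow S (j + k)}" for k
  proof (rule subspace_pow_subsetI)
    show "csubspace {Y. X ** Y \<in> subspace_pow S (j + k)}" for k
      using csubspace_subspace_pow[of S "j + k"]
      by (auto simp: csubspace_def cm.subspace_def matrix_add_ldistrib cscale_mult_right)
  qed (auto simp: assms(1) matrix_mul_assoc intro: mult_mem_subspace_pow_Suc)
  then show ?thesis
    using assms(2) by blast
qed

lemma adj_mem_subspace_pow: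
  assumes "operator_system S" and "X \<in> subspace_pow S k"
  shows "adj X \<in> subspace_pow S k"
proof -
  have "subspace_pow S k \<subseteq> {Y. adj Y \<in> subspace_pow S k}" for k
  proof (rule subspace_pow_subsetI)
    show "csubspace {Y. adj Y \<in> subspace_pow S k}" for k
      using csubspace_subspace_pow[of S k]
      by (auto simp: csubspace_def cm.subspace_def adj_add adj_cscale)
  next
    fix k X A
    assume "X \<in> {Y. adj Y \<in> subspace_pow S k}" and "A \<in> S"
    then have "adj A ** adj X \<in> subspace_pow S (Suc 0 + k)"
      using assms(1) subset_subspace_pow_1[OF assms(1)]
      by (intro subspace_pow_mult) (auto simp: operator_system_def)
    then show "X ** A \<in> {Y. adj Y \<in> subspace_pow S (Suc k)}"
      by (simp add: adj_mult)
  qed (simp add: cspan_def cm.span_base)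
  then show ?thesis
    using assms(2) by blast
qed

lemma subspace_pow_commute:
  assumes "\<And>A. A \<in> S \<Longrightarrow> P ** A = A ** P" and "X \<in> subspace_pow S k"
  shows "P ** X = X ** P"
proof -
  have "subspace_pow S k \<subseteq> {X. P ** X = X ** P}"
  proof (rule subspace_pow_subsetI)
    show "csubspace {X. P ** X = X ** P}"
      by (auto simp: csubspace_def cm.subspace_def matrix_add_ldistrib matrix_add_rdistrib
          cscale_mult_left cscale_mult_right)
    fix X A
    assume "X \<in> {X. P ** X = X ** P}" and "A \<in> S"
    then have "P ** (X ** A) = X ** (P ** A)"
      by (simp add: matrix_mul_assoc)
    also have "\<dots> = (X ** A) ** P"
      using assms(1) \<open>A \<in> S\<close> by (simp add: matrix_mul_assoc)
    finally show "X ** A \<in> {X. P ** X = X ** P}"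
      by simp
  qed simp
  then show ?thesis
    using assms(2) by blast
qed

lemma disconnected_if_reducing_projection:
  assumes S: "operator_system S" and P: "projection P" "P \<noteq> 0" "P \<noteq> mat 1"
    and reduces: "\<forall>A\<in>S. P ** A ** (mat 1 - P) = 0"
  shows "\<not> qgraph_connected S"
proof
  assume "qgraph_connected S"
  then obtain m where m: "subspace_pow S m = UNIV"
    by (auto simp: qgraph_connected_def)
  have "P ** A = A ** P" if "A \<in> S" for A
  proof (rule commute_if_off_diagonal_blocks_zero)
    show "P ** A ** (mat 1 - P) = 0"
      using reduces that by blast
    have "P ** adj A ** (mat 1 - P) = 0"
      using reduces that S by (simp add: operator_system_def)
    then show "(mat 1 - P) ** A ** P = 0"
      using adj_off_diagonal_block[OF P(1), of "adj A"] by simp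
  qed
  then have commute: "P ** X = X ** P" for X
    using m by (blast intro: subspace_pow_commute)
  have "P ** X ** (mat 1 - P) = 0" for X
  proof -
    have "P ** X ** (mat 1 - P) = X ** (P ** (mat 1 - P))"
      by (simp only: commute[of X] matrix_mul_assoc)
    also have "P ** (mat 1 - P) = 0"
      using P(1) by (simp add: projection_def matrix_diff_ldistrib)
    finally show ?thesis
      by simp
  qed
  then have "P = 0 \<or> mat 1 - P = 0"
    by (rule sandwiches_eq_0_imp)
  with P(2,3) show False
    by simp
qed

section \<open>Orthogonal projections\<close>

definition cinner :: "complex^'n \<Rightarrow> complex^'n \<Rightarrow> complex" where
  "cinner x y = (\<Sum>i\<in>UNIV. cnj (x $ i) * y $ i)"

lemma cinner_add_left: "cinner (x + y) z = cinner x z + cinner y z"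
  by (simp add: cinner_def algebra_simps sum.distrib)

lemma cinner_add_right: "cinner x (y + z) = cinner x y + cinner x z"
  by (simp add: cinner_def algebra_simps sum.distrib)

lemma cinner_diff_left: "cinner (x - y) z = cinner x z - cinner y z"
  by (simp add: cinner_def algebra_simps sum_subtractf)

lemma cinner_diff_right: "cinner x (y - z) = cinner x y - cinner x z"
  by (simp add: cinner_def algebra_simps sum_subtractf)

lemma cinner_scale_left: "cinner (c *s x) y = cnj c * cinner x y"
  by (simp add: cinner_def sum_distrib_left mult.assoc)

lemma cinner_scale_right: "cinner x (c *s y) = c * cinner x y"
  by (simp add: cinner_def sum_distrib_left mult.left_commute)

lemma cinner_zero_right [simp]: "cinner x 0 = 0"
  by (simp add: cinner_def)

lemma cinner_commute: "cinner y x = cnj (cinner x y)"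
  by (simp add: cinner_def mult.commute)

lemma cinner_adj: "cinner x (A *v y) = cinner (adj A *v x) y"
proof -
  have "cinner x (A *v y) = (\<Sum>i\<in>UNIV. \<Sum>j\<in>UNIV. cnj (x $ i) * (A $ i $ j * y $ j))"
    by (simp add: cinner_def matrix_vector_mult_def sum_distrib_left)
  also have "\<dots> = (\<Sum>j\<in>UNIV. \<Sum>i\<in>UNIV. cnj (x $ i) * (A $ i $ j * y $ j))"
    by (rule sum.swap)
  also have "\<dots> = cinner (adj A *v x) y"
    by (simp add: cinner_def matrix_vector_mult_def sum_distrib_left sum_distrib_right mult_ac)
  finally show ?thesis .
qed

lemma Re_cinner: "Re (cinner x y) = inner x y"
  by (simp add: inner_vec_def cinner_def inner_complex_def)

lemma cinner_self: "cinner x x = complex_of_real ((norm x)\<^sup>2)"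
proof -
  have "Im (cinner x x) = 0"
    by (simp add: cinner_def)
  then show ?thesis
    by (simp add: complex_eq_iff Re_cinner power2_norm_eq_inner)
qed

lemma cinner_self_eq_0: "cinner x x = 0 \<longleftrightarrow> x = 0"
  by (simp add: cinner_self)

lemma cinner_eq_0_if_Re_cinner_eq_0:
  assumes "Re (cinner x y) = 0" and "Re (cinner x (\<i> *s y)) = 0"
  shows "cinner x y = 0"
  using assms by (simp add: cinner_scale_right complex_eq_iff)

lemma scaleR_eq_of_real_scale: "c *\<^sub>R x = complex_of_real c *s (x::complex^'n)"
proof -
  have "(c *\<^sub>R x) $ i = complex_of_real c * x $ i" for i
    using scaleR_conv_of_real[of c "x $ i"] by simp
  then show ?thesis
    by (simp add: vec_eq_iff)
qed

lemma subspace_if_vec_subspace: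
  assumes "vec.subspace (V::(complex^'n) set)"
  shows "subspace V"
  using assms unfolding vec.subspace_def subspace_def by (auto simp: scaleR_eq_of_real_scale)

lemma orthogonal_decomposition:
  assumes V: "vec.subspace (V::(complex^'n) set)"
  shows "\<exists>!y. y \<in> V \<and> (\<forall>w\<in>V. cinner w (x - y) = 0)"
proof -
  have span: "span V = V"
    using subspace_if_vec_subspace[OF V] by simp
  obtain y z where y: "y \<in> span V" and z: "\<And>w. w \<in> span V \<Longrightarrow> orthogonal z w" and "x = y + z"
    using orthogonal_subspace_decomp_exists by blast
  have "cinner w z = 0" if w: "w \<in> V" for w
  proof -
    have "\<i> *s w \<in> V"
      using V w by (simp add: vec.subspace_scale)
    then have "cinner z w = 0"
      using z[of w] z[of "\<i> *s w"] w span
      by (intro cinner_eq_0_if_Re_cinner_eq_0)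
        (simp_all add: orthogonal_def Re_cinner)
    then show ?thesis
      by (simp add: cinner_commute[of w z])
  qed
  then have "y \<in> V \<and> (\<forall>w\<in>V. cinner w (x - y) = 0)"
    using y span \<open>x = y + z\<close> by auto
  moreover have "y1 = y2"
    if "y1 \<in> V" "\<forall>w\<in>V. cinner w (x - y1) = 0" "y2 \<in> V" "\<forall>w\<in>V. cinner w (x - y2) = 0" for y1 y2
  proof -
    have "y1 - y2 \<in> V"
      using V that by (simp add: vec.subspace_diff)
    then have "cinner (y1 - y2) (y1 - y2) = cinner (y1 - y2) (x - y2) - cinner (y1 - y2) (x - y1)"
      by (simp add: flip: cinner_diff_right)
    also have "\<dots> = 0"
      using that \<open>y1 - y2 \<in> V\<close> by simp
    finally show ?thesis
      by (simp add: cinner_self_eq_0)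
  qed
  ultimately show ?thesis
    by blast
qed

text \<open>For \<open>V\<close> not a subspace the description may fail and \<open>orth_proj V x\<close> is unspecified.\<close>

definition orth_proj :: "(complex^'n) set \<Rightarrow> complex^'n \<Rightarrow> complex^'n" where
  "orth_proj V x = (THE y. y \<in> V \<and> (\<forall>w\<in>V. cinner w (x - y) = 0))"

lemma orth_proj:
  assumes "vec.subspace V"
  shows "orth_proj V x \<in> V" and "\<forall>w\<in>V. cinner w (x - orth_proj V x) = 0"
  using theI'[OF orthogonal_decomposition[OF assms, of x]] by (simp_all add: orth_proj_def)

lemma orth_proj_eqI:
  assumes "vec.subspace V" and "y \<in> V" and "\<forall>w\<in>V. cinner w (x - y) = 0"
  shows "orth_proj V x = y"
  unfolding orth_proj_def using assms by (intro the1_equality orthogonal_decomposition) auto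

lemma orth_proj_id: "vec.subspace V \<Longrightarrow> v \<in> V \<Longrightarrow> orth_proj V v = v"
  by (rule orth_proj_eqI) simp_all

lemma linear_orth_proj:
  assumes V: "vec.subspace V"
  shows "Vector_Spaces.linear (*s) (*s) (orth_proj V)"
proof
  fix x y
  show "orth_proj V (x + y) = orth_proj V x + orth_proj V y"
    using orth_proj[OF V] V
    by (intro orth_proj_eqI) (simp_all add: vec.subspace_add add_diff_add cinner_add_right)
next
  fix c x
  show "orth_proj V (c *s x) = c *s orth_proj V x"
    using orth_proj[OF V] V
    by (intro orth_proj_eqI)
      (simp_all add: vec.subspace_scale cinner_scale_right flip: vector_ssub_ldistrib)
qed

lemma matrix_orth_proj: "vec.subspace V \<Longrightarrow> matrix (orth_proj V) *v x = orth_proj V x"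
  by (rule matrix_works[OF linear_orth_proj])

lemma projection_matrix_orth_proj:
  assumes V: "vec.subspace V"
  shows "projection (matrix (orth_proj V))"
proof -
  define P where "P = matrix (orth_proj V)"
  have P: "P *v x = orth_proj V x" for x
    unfolding P_def using V by (rule matrix_orth_proj)
  have "P ** P = P"
    by (simp add: matrix_eq P orth_proj[OF V] orth_proj_id[OF V] flip: matrix_vector_mul_assoc)
  moreover have "cinner w (adj P *v x) = cinner w (P *v x)" for w x
  proof -
    have "cinner w (adj P *v x) = cinner (P *v w) x"
      using cinner_adj[of w "adj P" x] by simp
    also have "\<dots> = cinner (P *v w) (P *v x) + cinner (P *v w) (x - P *v x)"
      by (simp add: cinner_diff_right)
    also have "\<dots> = cinner (P *v w) (P *v x) + cnj (cinner (P *v x) (w - P *v w))"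
      using orth_proj[OF V] by (simp add: P)
    also have "\<dots> = cinner w (P *v x)"
      by (simp add: cinner_commute[of "P *v x"] cinner_diff_left)
    finally show ?thesis .
  qed
  then have "adj P *v x = P *v x" for x
    using cinner_self_eq_0[of "adj P *v x - P *v x"] by (simp add: cinner_diff_right)
  then have "adj P = P"
    by (simp add: matrix_eq)
  ultimately show ?thesis
    by (simp add: projection_def P_def)
qed

section \<open>Compressions of Hermitian matrices\<close>

lemma linear_term_zero_if_quadratic_nonneg:
  fixes a b :: real
  assumes "\<And>t. 0 \<le> 2 * t * a + t\<^sup>2 * b"
  shows "a = 0"
proof (rule ccontr)
  assume "a \<noteq> 0"
  define d where "d = \<bar>b\<bar> + 1"
  define t where "t = - a / d"
  have "d > 0" and td: "t * d = - a"
    by (simp_all add: d_def t_def)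
  have "(2 * t * a + t\<^sup>2 * b) * d\<^sup>2 = 2 * a * (t * d) * d + b * (t * d)\<^sup>2"
    by (simp add: power2_eq_square algebra_simps)
  also have "\<dots> = a\<^sup>2 * (b - 2 * d)"
    unfolding td by (simp add: power2_eq_square algebra_simps)
  also have "\<dots> < 0"
    using \<open>a \<noteq> 0\<close> by (intro mult_pos_neg) (auto simp: d_def)
  finally show False
    using assms[of t] \<open>d > 0\<close> by (simp add: mult_less_0_iff)
qed

lemma cinner_hermitian_swap:
  assumes "adj D = D"
  shows "cinner y (D *v z) = cnj (cinner z (D *v y))"
proof -
  have "cinner y (D *v z) = cinner (D *v y) z"
    using cinner_adj[of y D z] assms by simp
  also have "\<dots> = cnj (cinner z (D *v y))"
    by (rule cinner_commute)
  finally show ?thesis .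
qed

lemma nonneg_form_zero_imp_orthogonal:
  assumes D: "adj D = D" and W: "vec.subspace W"
    and nonneg: "\<And>z. z \<in> W \<Longrightarrow> 0 \<le> Re (cinner z (D *v z))"
    and y: "y \<in> W" "Re (cinner y (D *v y)) = 0" and z: "z \<in> W"
  shows "cinner z (D *v y) = 0"
proof -
  have Re_zero: "Re (cinner u (D *v y)) = 0" if u: "u \<in> W" for u
  proof (rule linear_term_zero_if_quadratic_nonneg)
    fix t :: real
    have "y + complex_of_real t *s u \<in> W"
      using W u y by (simp add: vec.subspace_add vec.subspace_scale)
    then have "0 \<le> Re (cinner (y + complex_of_real t *s u) (D *v (y + complex_of_real t *s u)))"
      by (rule nonneg)
    also have "\<dots> = 2 * t * Re (cinner u (D *v y)) + t\<^sup>2 * Re (cinner u (D *v u))"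
      using y(2) cinner_hermitian_swap[OF D, of y u]
      by (simp add: vec.add vec.scale cinner_add_left cinner_add_right cinner_scale_left
          cinner_scale_right power2_eq_square algebra_simps)
    finally show "0 \<le> 2 * t * Re (cinner u (D *v y)) + t\<^sup>2 * Re (cinner u (D *v u))" .
  qed
  have "\<i> *s z \<in> W"
    using W z by (simp add: vec.subspace_scale)
  then have "Re (cinner z (D *v y)) = 0" and "Im (cinner z (D *v y)) = 0"
    using Re_zero[of z] Re_zero[of "\<i> *s z"] z by (simp_all add: cinner_scale_left)
  then show ?thesis
    by (simp add: complex_eq_iff)
qed

lemma quadratic_form_attains_max_on_sphere:
  assumes W: "vec.subspace (W::(complex^'n) set)" and "W \<noteq> {0}"
  shows "\<exists>y\<in>W. norm y = 1 \<and> (\<forall>z\<in>W. Re (cinner z (h *v z)) \<le> Re (cinner y (h *v y)) * (norm z)\<^sup>2)"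
proof -
  define f where "f z = Re (cinner z (h *v z))" for z
  have f_scaleR: "f (c *\<^sub>R z) = c\<^sup>2 * f z" for c z
    by (simp add: f_def scaleR_eq_of_real_scale vec.scale cinner_scale_left cinner_scale_right
        power2_eq_square)
  have sub: "subspace W"
    using W by (rule subspace_if_vec_subspace)
  obtain u where "u \<in> W" "u \<noteq> 0"
    using \<open>W \<noteq> {0}\<close> vec.subspace_0[OF W] by blast
  then have "(1 / norm u) *\<^sub>R u \<in> W \<inter> sphere 0 1"
    using sub by (simp add: subspace_scale)
  moreover have "compact (W \<inter> sphere 0 1)"
    using sub by (intro closed_Int_compact closed_subspace compact_sphere)
  moreover have "continuous_on (W \<inter> sphere 0 1) f"
    unfolding f_def cinner_def matrix_vector_mult_def by (intro continuous_intros)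
  ultimately obtain y where y: "y \<in> W \<inter> sphere 0 1" and max: "\<And>z. z \<in> W \<inter> sphere 0 1 \<Longrightarrow> f z \<le> f y"
    using continuous_attains_sup[of "W \<inter> sphere 0 1" f] by blast
  have "f z \<le> f y * (norm z)\<^sup>2" if z: "z \<in> W" for z
  proof (cases "z = 0")
    case True
    then show ?thesis
      by (simp add: f_def)
  next
    case False
    then have "f ((1 / norm z) *\<^sub>R z) \<le> f y"
      using z sub by (intro max) (simp add: subspace_scale)
    then show ?thesis
      using False by (simp add: f_scaleR field_simps)
  qed
  then show ?thesis
    using y by (auto simp: f_def)
qed

lemma hermitian_compression_eigenvector:
  assumes h: "adj h = h" and W: "vec.subspace (W::(complex^'n) set)" and "W \<noteq> {0}"
  shows "\<exists>y\<in>W. y \<noteq> 0 \<and> (\<exists>l::real. \<forall>z\<in>W. cinner z ((mat (complex_of_real l) - h) *v y) = 0)"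
proof -
  obtain y where y: "y \<in> W" "norm y = 1"
    and max: "\<And>z. z \<in> W \<Longrightarrow> Re (cinner z (h *v z)) \<le> Re (cinner y (h *v y)) * (norm z)\<^sup>2"
    using quadratic_form_attains_max_on_sphere[OF W \<open>W \<noteq> {0}\<close>] by blast
  define l where "l = Re (cinner y (h *v y))"
  define D where "D = mat (complex_of_real l) - h"
  txt \<open>By maximality of the Rayleigh quotient at \<open>y\<close>, the form of \<open>D\<close> is nonnegative on \<open>W\<close>
    and vanishes at \<open>y\<close>.\<close>
  have D_form: "Re (cinner z (D *v z)) = l * (norm z)\<^sup>2 - Re (cinner z (h *v z))" for z
  proof -
    have "D *v z = complex_of_real l *s z - h *v z"
      by (simp add: D_def matrix_vector_mult_diff_rdistrib mat_mult_vector)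
    then have "cinner z (D *v z) = complex_of_real l * cinner z z - cinner z (h *v z)"
      by (simp add: cinner_diff_right cinner_scale_right)
    then show ?thesis
      by (simp add: cinner_self)
  qed
  have orth: "cinner z (D *v y) = 0" if "z \<in> W" for z
  proof (rule nonneg_form_zero_imp_orthogonal[OF _ W _ y(1) _ that])
    show "adj D = D"
      by (simp add: D_def adj_diff h)
    show "0 \<le> Re (cinner z (D *v z))" if "z \<in> W" for z
      using max[OF that] unfolding D_form l_def by linarith
    show "Re (cinner y (D *v y)) = 0"
      unfolding D_form y(2) l_def by simp
  qed
  show ?thesis
  proof (intro bexI conjI exI ballI)
    show "y \<noteq> 0"
      using y(2) by auto
    show "cinner z ((mat (complex_of_real l) - h) *v y) = 0" if "z \<in> W" for z
      using orth[OF that] by (simp only: D_def)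
  qed (fact y(1))
qed

lemma dim_range_mult_less:
  fixes T :: "'a::field^'n^'m" and G :: "'a^'m^'k"
  assumes y: "y \<in> range ((*v) T)" "y \<noteq> 0" "G *v y = 0"
  shows "vec.dim (range ((*v) (G ** T))) < vec.dim (range ((*v) T))"
proof -
  define W where "W = range ((*v) T)"
  obtain B where B: "{y} \<subseteq> B" "B \<subseteq> W" "vec.independent B" "W \<subseteq> vec.span B"
    using vec.maximal_independent_subset_extend[of "{y}" W] y(1,2)
    by (auto simp: W_def vec.dependent_single)
  have fin: "finite B"
    using B(3) by (rule vec.finiteI_independent)
  have "range ((*v) (G ** T)) = (*v) G ` W"
    by (auto simp: W_def image_iff simp flip: matrix_vector_mul_assoc)
  also have "\<dots> \<subseteq> vec.span ((*v) G ` B)"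
    using B(4) by (rule vec.spans_image)
  also have "\<dots> \<subseteq> vec.span (insert 0 ((*v) G ` (B - {y})))"
    using y(3) by (intro vec.span_mono) auto
  finally have "vec.dim (range ((*v) (G ** T))) \<le> card ((*v) G ` (B - {y}))"
    using fin by (intro vec.dim_le_card) auto
  also have "\<dots> \<le> card (B - {y})"
    using fin by (intro card_image_le) auto
  also have "\<dots> < card B"
    using fin B(1) by (intro card_Diff1_less) auto
  also have "\<dots> = vec.dim W"
    using B by (intro vec.dim_unique[symmetric]) auto
  finally show ?thesis
    by (simp add: W_def)
qed

section \<open>Unital *-subalgebras without reducing projections\<close>

definition star_subalgebra :: "(complex^'n^'n) set \<Rightarrow> bool" where
  "star_subalgebra A \<longleftrightarrow> csubspace A \<and> mat 1 \<in> A \<and> (\<forall>X\<in>A. \<forall>Y\<in>A. X ** Y \<in> A)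
     \<and> (\<forall>X\<in>A. adj X \<in> A)"

lemma vec_subspace_orbit:
  assumes "csubspace A"
  shows "vec.subspace ((\<lambda>a. a *v x) ` A)"
  unfolding vec.subspace_def
proof (intro conjI ballI allI)
  have sub: "cm.subspace A"
    using assms by (simp add: csubspace_def)
  show "0 \<in> (\<lambda>a. a *v x) ` A"
    using cm.subspace_0[OF sub] by force
  fix u v assume "u \<in> (\<lambda>a. a *v x) ` A" "v \<in> (\<lambda>a. a *v x) ` A"
  then obtain a b where "a \<in> A" "b \<in> A" "u = a *v x" "v = b *v x"
    by blast
  then show "u + v \<in> (\<lambda>a. a *v x) ` A"
    using cm.subspace_add[OF sub] by (force simp: matrix_vector_mult_add_rdistrib)
  fix c
  show "c *s u \<in> (\<lambda>a. a *v x) ` A"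
    using cm.subspace_scale[OF sub] \<open>a \<in> A\<close> \<open>u = a *v x\<close> by (force simp: cscale_mv)
qed

lemma star_subalgebra_transitive:
  assumes A: "star_subalgebra A"
    and irreducible: "\<And>P. projection P \<Longrightarrow> \<forall>X\<in>A. P ** X ** (mat 1 - P) = 0 \<Longrightarrow> P = 0 \<or> P = mat 1"
    and "x \<noteq> 0"
  shows "\<exists>a\<in>A. a *v x = y"
proof -
  txt \<open>The orthogonal projection onto the \<open>A\<close>-invariant subspace \<open>A x\<close> reduces \<open>A\<close>.\<close>
  define V where "V = (\<lambda>a. a *v x) ` A"
  have V: "vec.subspace V"
    using A by (simp add: V_def star_subalgebra_def vec_subspace_orbit)
  define P where "P = matrix (orth_proj V)"
  have P: "projection P" "\<And>z. P *v z \<in> V" "\<And>v. v \<in> V \<Longrightarrow> P *v v = v"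
    using projection_matrix_orth_proj[OF V] orth_proj[OF V] orth_proj_id[OF V]
    by (simp_all add: P_def matrix_orth_proj[OF V])
  have "(mat 1 - P) ** X ** P = 0" if X: "X \<in> A" for X
  proof (rule matrix_eq[THEN iffD2, rule_format])
    fix z
    obtain b where b: "b \<in> A" "P *v z = b *v x"
      using P(2)[of z] by (auto simp: V_def)
    then have "X *v (P *v z) \<in> V"
      using A X by (auto simp: V_def star_subalgebra_def matrix_vector_mul_assoc)
    then show "((mat 1 - P) ** X ** P) *v z = 0 *v z"
      using P(3) by (simp add: matrix_vector_mult_diff_rdistrib flip: matrix_vector_mul_assoc)
  qed
  then have "\<forall>X\<in>A. P ** X ** (mat 1 - P) = 0"
    using A adj_off_diagonal_block[OF P(1)] by (metis adj_adj adj_zero star_subalgebra_def)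
  then have "P = 0 \<or> P = mat 1"
    using irreducible P(1) by blast
  moreover have "x \<in> V"
    using A by (auto simp: V_def star_subalgebra_def intro: image_eqI[of _ _ "mat 1"])
  then have "P \<noteq> 0"
    using P(3) \<open>x \<noteq> 0\<close> by force
  ultimately have "y \<in> V"
    using P(2)[of y] by simp
  then show ?thesis
    by (auto simp: V_def)
qed

lemma hermitian_decomposition:
  assumes A: "star_subalgebra A" and a: "a \<in> A"
  shows "\<exists>h1 h2. h1 \<in> A \<and> h2 \<in> A \<and> adj h1 = h1 \<and> adj h2 = h2 \<and> a = h1 + cscale \<i> h2"
proof (intro exI conjI)
  have sub: "cm.subspace A" and "adj a \<in> A"
    using A a by (simp_all add: star_subalgebra_def csubspace_def)
  then show "cscale (1/2) (a + adj a) \<in> A"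
    using a by (intro cm.subspace_scale cm.subspace_add)
  show "cscale (- \<i>/2) (a - adj a) \<in> A"
    using sub a \<open>adj a \<in> A\<close> by (intro cm.subspace_scale cm.subspace_diff)
  show "adj (cscale (1/2) (a + adj a)) = cscale (1/2) (a + adj a)"
    by (simp add: adj_cscale adj_add add.commute)
  show "adj (cscale (- \<i>/2) (a - adj a)) = cscale (- \<i>/2) (a - adj a)"
    by (simp add: vec_eq_iff algebra_simps)
  show "a = cscale (1/2) (a + adj a) + cscale \<i> (cscale (- \<i>/2) (a - adj a))"
    by (simp add: vec_eq_iff field_simps)
qed

definition minimal_hermitian :: "(complex^'n^'n) set \<Rightarrow> complex^'n^'n \<Rightarrow> bool" where
  "minimal_hermitian A T \<longleftrightarrow> T \<in> A \<and> adj T = T \<and> T \<noteq> 0 \<and>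
     (\<forall>T'\<in>A. adj T' = T' \<and> T' \<noteq> 0 \<longrightarrow> vec.dim (range ((*v) T)) \<le> vec.dim (range ((*v) T')))"

lemma minimal_hermitian_exists:
  assumes "star_subalgebra A"
  shows "\<exists>T. minimal_hermitian A T"
proof -
  define hermitian where "hermitian T \<longleftrightarrow> T \<in> A \<and> adj T = T \<and> T \<noteq> 0" for T
  have "mat 1 \<noteq> (0::complex^'n^'n)"
    by (simp add: vec_eq_iff mat_def)
  then have "hermitian (mat 1)"
    using assms by (simp add: hermitian_def star_subalgebra_def)
  then obtain T where "hermitian T"
    and "\<And>T'. hermitian T' \<Longrightarrow> vec.dim (range ((*v) T)) \<le> vec.dim (range ((*v) T'))"
    using ex_has_least_nat[of hermitian "mat 1" "\<lambda>T. vec.dim (range ((*v) T))"] by blast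
  then show ?thesis
    unfolding minimal_hermitian_def hermitian_def by blast
qed

lemma minimal_hermitian_compression_hermitian:
  assumes A: "star_subalgebra A" and T: "minimal_hermitian A T" and h: "h \<in> A" "adj h = h"
  shows "\<exists>\<mu>. T ** h ** T = cscale \<mu> (T ** T)"
proof -
  have TA: "T \<in> A" and Th: "adj T = T" and "T \<noteq> 0"
    using T by (simp_all add: minimal_hermitian_def)
  then obtain x where "T *v x \<noteq> 0"
    using matrix_eq[of T 0] by auto
  then have "range ((*v) T) \<noteq> {0}"
    by blast
  moreover have "vec.subspace (range ((*v) T))"
    by (rule vec.subspace_image[OF vec.subspace_UNIV])
  ultimately obtain y l where y: "y \<in> range ((*v) T)" "y \<noteq> 0"
    and orth: "\<forall>z\<in>range ((*v) T). cinner z ((mat (complex_of_real l) - h) *v y) = 0"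
    using hermitian_compression_eigenvector[OF h(2)] by metis
  define D where "D = mat (complex_of_real l) - h"
  txt \<open>\<open>T D\<close> kills \<open>y\<close>, so the Hermitian element \<open>T D T\<close> of \<open>A\<close> has smaller rank than \<open>T\<close>.\<close>
  have "cinner u ((T ** D) *v y) = 0" for u
    using orth by (simp add: D_def cinner_adj Th flip: matrix_vector_mul_assoc)
  then have "(T ** D) *v y = 0"
    using cinner_self_eq_0 by blast
  then have "vec.dim (range ((*v) (T ** D ** T))) < vec.dim (range ((*v) T))"
    using dim_range_mult_less[OF y] by blast
  moreover have "cscale (complex_of_real l) (mat 1) - h \<in> A"
    using A h(1) by (intro cm.subspace_diff cm.subspace_scale) (auto simp: star_subalgebra_def csubspace_def)
  then have "D \<in> A"
    unfolding D_def mat_eq_cscale[of "complex_of_real l"] .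
  then have "T ** D ** T \<in> A"
    using A TA by (simp add: star_subalgebra_def)
  moreover have "adj (T ** D ** T) = T ** D ** T"
    by (simp add: D_def adj_mult adj_diff Th h(2) matrix_mul_assoc)
  ultimately have "T ** D ** T = 0"
    using T by (auto simp: minimal_hermitian_def)
  moreover have "T ** D ** T = cscale (complex_of_real l) (T ** T) - T ** h ** T"
    by (simp add: D_def matrix_diff_ldistrib matrix_diff_rdistrib mult_mat_eq_cscale cscale_mult_left)
  ultimately have "T ** h ** T = cscale (complex_of_real l) (T ** T)"
    by simp
  then show ?thesis ..
qed

lemma minimal_hermitian_compression:
  assumes A: "star_subalgebra A" and T: "minimal_hermitian A T" and a: "a \<in> A"
  shows "\<exists>\<mu>. T ** a ** T = cscale \<mu> (T ** T)"
proof -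
  obtain h1 h2 where h: "h1 \<in> A" "h2 \<in> A" "adj h1 = h1" "adj h2 = h2" and "a = h1 + cscale \<i> h2"
    using hermitian_decomposition[OF A a] by blast
  then have "T ** a ** T = T ** h1 ** T + cscale \<i> (T ** h2 ** T)"
    by (simp add: matrix_add_ldistrib matrix_add_rdistrib cscale_mult_left cscale_mult_right)
  moreover obtain \<mu>1 \<mu>2 where "T ** h1 ** T = cscale \<mu>1 (T ** T)" "T ** h2 ** T = cscale \<mu>2 (T ** T)"
    using minimal_hermitian_compression_hermitian[OF A T] h by metis
  ultimately have "T ** a ** T = cscale (\<mu>1 + \<i> * \<mu>2) (T ** T)"
    by (simp add: vec_eq_iff algebra_simps)
  then show ?thesis ..
qed

lemma rank_one_if_range_in_line:
  fixes T :: "'a::comm_semiring_1^'n^'m"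
  assumes "\<And>y. \<exists>\<mu>. T *v y = \<mu> *s w"
  shows "\<exists>\<nu>. \<forall>i j. T $ i $ j = w $ i * \<nu> $ j"
proof -
  have "\<forall>j. \<exists>\<mu>. T *v axis j 1 = \<mu> *s w"
    using assms by blast
  then obtain \<nu> where \<nu>: "\<And>j. T *v axis j 1 = \<nu> j *s w"
    by (auto simp: choice_iff)
  have "T $ i $ j = w $ i * (\<chi> j. \<nu> j) $ j" for i j
    using arg_cong[OF \<nu>[of j], of "\<lambda>v. v $ i"]
    by (simp add: matrix_vector_mult_axis_nth mult.commute)
  then show ?thesis
    by blast
qed

lemma rank_one_sandwich_eq_matrix_unit:
  fixes T a b :: "complex^'n^'n"
  assumes T: "\<And>i j. T $ i $ j = w $ i * \<nu> $ j"
    and a: "a *v w = axis r 1" and b: "b *v (\<chi> j. cnj (\<nu> $ j)) = axis s 1"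
  shows "a ** T ** adj b = matrix_unit r s"
proof -
  have "(a ** T ** adj b) $ p $ q = (a *v w) $ p * cnj ((b *v (\<chi> j. cnj (\<nu> $ j))) $ q)" for p q
    by (simp add: matrix_matrix_mult_def matrix_vector_mult_def T sum_distrib_left
        sum_distrib_right mult_ac)
  then show ?thesis
    by (simp add: vec_eq_iff a b axis_def matrix_unit_def)
qed

lemma minimal_hermitian_range_in_line:
  assumes A: "star_subalgebra A" and T: "minimal_hermitian A T"
    and transitive: "\<And>u v. u \<noteq> 0 \<Longrightarrow> \<exists>a\<in>A. a *v u = v"
  shows "\<exists>w. w \<noteq> 0 \<and> (\<forall>y. \<exists>\<mu>. T *v y = \<mu> *s w)"
proof -
  have Th: "adj T = T" and "T \<noteq> 0"
    using T by (simp_all add: minimal_hermitian_def)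
  then obtain x where x: "T *v x \<noteq> 0"
    using matrix_eq[of T 0] by auto
  have "cinner x (T *v (T *v x)) = cinner (T *v x) (T *v x)"
    by (simp add: cinner_adj Th)
  then have "T *v (T *v x) \<noteq> 0"
    using x cinner_self_eq_0 by fastforce
  moreover have "\<exists>\<mu>. T *v y = \<mu> *s (T *v (T *v x))" for y
  proof -
    obtain a where a: "a \<in> A" "a *v (T *v x) = y"
      using transitive[OF x] by blast
    obtain \<mu> where \<mu>: "T ** a ** T = cscale \<mu> (T ** T)"
      using minimal_hermitian_compression[OF A T a(1)] by blast
    have "T *v y = (T ** a ** T) *v x"
      by (simp add: a(2)[symmetric] matrix_vector_mul_assoc matrix_mul_assoc)
    also have "\<dots> = \<mu> *s (T *v (T *v x))"
      by (simp add: \<mu> cscale_mv matrix_vector_mul_assoc)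
    finally show ?thesis ..
  qed
  ultimately show ?thesis
    by blast
qed

theorem matrix_unit_mem_if_irreducible:
  assumes A: "star_subalgebra A"
    and irreducible: "\<And>P. projection P \<Longrightarrow> \<forall>X\<in>A. P ** X ** (mat 1 - P) = 0 \<Longrightarrow> P = 0 \<or> P = mat 1"
  shows "matrix_unit r s \<in> A"
proof -
  have transitive: "\<exists>a\<in>A. a *v u = v" if "u \<noteq> 0" for u v
    using A irreducible that by (rule star_subalgebra_transitive)
  obtain T where T: "minimal_hermitian A T"
    using minimal_hermitian_exists[OF A] by blast
  then obtain w where "w \<noteq> 0" and "\<forall>y. \<exists>\<mu>. T *v y = \<mu> *s w"
    using minimal_hermitian_range_in_line[OF A _ transitive] by blast
  then obtain \<nu> where \<nu>: "\<And>i j. T $ i $ j = w $ i * \<nu> $ j"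
    using rank_one_if_range_in_line by metis
  have "(\<chi> j. cnj (\<nu> $ j)) \<noteq> 0"
    using T by (auto simp: minimal_hermitian_def vec_eq_iff \<nu>)
  then obtain b where b: "b \<in> A" "b *v (\<chi> j. cnj (\<nu> $ j)) = axis s 1"
    using transitive by blast
  obtain a where a: "a \<in> A" "a *v w = axis r 1"
    using transitive[OF \<open>w \<noteq> 0\<close>] by blast
  have "a ** T ** adj b \<in> A"
    using A T a(1) b(1) by (simp add: star_subalgebra_def minimal_hermitian_def)
  then show ?thesis
    using rank_one_sandwich_eq_matrix_unit[OF \<nu> a(2) b(2)] by simp
qed

section \<open>Connectedness\<close>

lemma star_subalgebra_UN_subspace_pow:
  assumes "operator_system S"
  shows "star_subalgebra (\<Union>k. subspace_pow S k)"
proof -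
  have "csubspace (\<Union>k. subspace_pow S k)"
    unfolding csubspace_def cm.subspace_def
  proof (intro conjI ballI allI)
    show "0 \<in> (\<Union>k. subspace_pow S k)"
      using cm.subspace_0 csubspace_subspace_pow unfolding csubspace_def by blast
  next
    fix X Y assume "X \<in> (\<Union>k. subspace_pow S k)" "Y \<in> (\<Union>k. subspace_pow S k)"
    then obtain j k where "X \<in> subspace_pow S j" "Y \<in> subspace_pow S k" by blast
    then have "X \<in> subspace_pow S (max j k)" "Y \<in> subspace_pow S (max j k)"
      using subspace_pow_mono[OF assms] by (meson max.cobounded1 max.cobounded2 subsetD)+
    then have "X + Y \<in> subspace_pow S (max j k)"
      using csubspace_subspace_pow[of S "max j k"] by (simp add: csubspace_def cm.subspace_add)
    then show "X + Y \<in> (\<Union>k. subspace_pow S k)"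
      by blast
  next
    fix c X assume "X \<in> (\<Union>k. subspace_pow S k)"
    then obtain k where "X \<in> subspace_pow S k"
      by blast
    then have "cscale c X \<in> subspace_pow S k"
      using csubspace_subspace_pow[of S k] by (simp add: csubspace_def cm.subspace_scale)
    then show "cscale c X \<in> (\<Union>k. subspace_pow S k)"
      by blast
  qed
  moreover have "X ** Y \<in> (\<Union>k. subspace_pow S k)"
    if "X \<in> (\<Union>k. subspace_pow S k)" and "Y \<in> (\<Union>k. subspace_pow S k)" for X Y
    using that subspace_pow_mult[of X S _ Y] by blast
  moreover have "adj X \<in> (\<Union>k. subspace_pow S k)" if "X \<in> (\<Union>k. subspace_pow S k)" for X
    using that adj_mem_subspace_pow[OF assms] by blast
  ultimately show ?thesis
    using mat_1_mem_subspace_pow[OF assms] by (auto simp: star_subalgebra_def)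
qed

lemma connected_if_irreducible:
  assumes S: "operator_system S"
    and irreducible: "\<And>P. projection P \<Longrightarrow> \<forall>A\<in>S. P ** A ** (mat 1 - P) = 0 \<Longrightarrow> P = 0 \<or> P = mat 1"
  shows "qgraph_connected S"
proof -
  have "P = 0 \<or> P = mat 1"
    if "projection P" "\<forall>X\<in>(\<Union>k. subspace_pow S k). P ** X ** (mat 1 - P) = 0" for P
    using that irreducible subset_subspace_pow_1[OF S] by blast
  then have "matrix_unit r s \<in> (\<Union>k. subspace_pow S k)" for r s
    by (rule matrix_unit_mem_if_irreducible[OF star_subalgebra_UN_subspace_pow[OF S]])
  then have "\<forall>r s. \<exists>k. matrix_unit r s \<in> subspace_pow S k"
    by blast
  then obtain k where k: "\<forall>r s. matrix_unit r s \<in> subspace_pow S (k r s)"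
    by (auto simp: choice_iff)
  define m where "m = Max (range (case_prod k))"
  have "matrix_unit r s \<in> subspace_pow S m" for r s
  proof -
    have "k r s \<le> m"
      unfolding m_def by (rule Max_ge) (auto intro: image_eqI[of _ _ "(r, s)"])
    then show ?thesis
      using subspace_pow_mono[OF S] k by blast
  qed
  then have "subspace_pow S m = UNIV"
    by (intro csubspace_eq_UNIV_if_matrix_units csubspace_subspace_pow)
  then show ?thesis
    by (auto simp: qgraph_connected_def)
qed

theorem theorem3p3:
  fixes S :: "(complex^'n^'n) set"
  assumes "operator_system S"
  shows "\<not> qgraph_connected S \<longleftrightarrow>
    (\<exists>P. projection P \<and> P \<noteq> 0 \<and> P \<noteq> mat 1 \<and> (\<forall>A\<in>S. P ** A ** (mat 1 - P) = 0))"
  using connected_if_irreducible[OF assms] disconnected_if_reducing_projection[OF assms] by blast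

end
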